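(* Assume $q_\alpha=0$ and the no-flow boundary condition (zero normal flux $\check M_{\alpha,2}\nabla_h(p_h^{k+\frac12}+\mu_{\alpha,h}^{k+\frac12})$ on boundary faces), $\alpha=w,n$. Let $S_{\alpha,h}^{k-1},S_{\alpha,h}^k,S_{\alpha,h}^{k+1}\in\mathcal C_h$ have values in $(0,1)$ with $S_{w,h}^j+S_{n,h}^j=1$ for $j=k-1,k,k+1$, let the face mobilities $\check M_{\alpha,2}$ be well defined and positive on every interior face, and let $p_h^{k+\frac12}\in\mathcal C_h$ be such that the second-order scheme holds: $$\phi_h\frac{S_{\alpha,h}^{k+1}-S_{\alpha,h}^k}{\Delta t}-\nabla_h\cdot\big(\check M_{\alpha,2}\nabla_h(p_h^{k+\frac12}+\mu_{\alpha,h}^{k+\frac12})\big)=0,\quad\alpha=w,n,$$ $$\mu_{w,h}^{k+\frac12}=\sigma_w\big(\mathcal H(S_{w,h}^{k+1},S_{w,h}^k)-1\big)+\sigma_{wn}S_{n,h}^{k+\frac12}+\Delta t(\ln S_{w,h}^{k+1}-\ln S_{w,h}^k),$$ $$\mu_{n,h}^{k+\frac12}=\sigma_n\big(\mathcal H(S_{n,h}^{k+1},S_{n,h}^k)-1\big)+\sigma_{wn}S_{w,h}^{k+\frac12}+\Delta t(\ln S_{n,h}^{k+1}-\ln S_{n,h}^k).$$ Then the discrete original energy dissipation law holds: $$\frac{\mathcal E_{tol,h}^{k+1}-\mathcal E_{tol,h}^k}{\Delta t}\le-\sum_{\alpha=w,n}\Big\|(\check M_{\alpha,2})^{1/2}\,\nabla_h(p_h^{k+\frac12}+\mu_{\alpha,h}^{k+\frac12})\Big\|_h^2\le0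 .$$
   Context: Grid. $d\in\{2,3\}$; $\Omega=\prod_{l=1}^d[a_l,b_l]$ is divided uniformly into cubic cells of side $h$, with $N_l=(b_l-a_l)/h$ a positive integer. $\mathcal C_h$ is the space of real functions on the set of cell centers. For an interior face shared by two cells adjacent in direction $l$, $(\nabla_h c)$ on that face is $(c^+-c^-)/h$, where $c^\pm$ are the values of $c$ at the two adjacent cell centers ($+$ being the one with the larger $l$-th coordinate). For a real function $u$ on faces, $(\nabla_h\cdot u)$ at a cell is $\sum_{l=1}^d (u_{l,\text{upper}}-u_{l,\text{lower}})/h$, the sum over the two faces of the cell orthogonal to direction $l$; in $\nabla_h\cdot(M\nabla_h c)$ the flux is $0$ on every boundary face. Inner product: $(c,c')_h=h^d\sum_{\text{cells}}c\,c'$ on $\mathcal C_h$; for face functions, $\|u\|_h^2=h^d\sum_{\text{interior faces}}u^2$. Parameters. $\Delta t>0$, $m>0$, $K>0$, $\eta_w,\eta_n>0$, $\sigma_w,\sigma_n,\sigma_{wn}>0$ are real constants; $\phi_h\in\mathcal C_h$ is time-independent with $0<\phi_h<1$. $q_\alpha$ denotes the injection/production rate of phase $\alpha$ (zero here). Notation. $S_{\alpha,h}^{k+\frac12}=\frac12(S_{\alpha,h}^{k+1}+S_{\alpha,h}^k)$. For $x,a>0$, $\mathcal H(x,a)=\frac{x\ln x-a\ln a}{x-a}$ if $x\ne a$, and $\mathcal H(a,a)=\ln a+1$ (applied pointwise). $\tilde S_{\alpha,h}^{k+1}=\frac32S_{\alpha,h}^k-\frac12S_{\alpha,h}^{k-1}$.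 Mobilities. On each interior face let $A_\alpha$ be the arithmetic mean of the values of $K(\tilde S_{\alpha,h}^{k+1})^m/\eta_\alpha$ at the two adjacent cell centers. The face mobility is $\check M_{\alpha,2}=A_\alpha$, or, in the regularized variant of the scheme, $\check M_{\alpha,2}=(A_\alpha^2+\Delta t^6)^{1/2}$; the statement holds for either choice. Discrete total energy: $\mathcal E_{tol,h}^k=(\phi_h,F(S_{w,h}^k,S_{n,h}^k))_h$ with $F(S_w,S_n)=\sum_{\alpha=w,n}\sigma_\alpha S_\alpha(\ln S_\alpha-1)+\sigma_{wn}S_wS_n$. *)

theory Defs
  imports "HOL-Analysis.Analysis"
begin

text \<open>
  The dimension $d$ is the cardinality of the index type \<open>'d\<close>. Discrete functions are total functions
  of a position, only evaluated where they live: a cell function at cell centers, a face function at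
  pairs of a direction \<open>l\<close> and the midpoint \<open>y\<close> of a face orthogonal to \<open>l\<close>. The two cells adjacent
  to such a face have centers \<open>y - half_step h l\<close> and \<open>y + half_step h l\<close>.
\<close>

type_synonym 'd cell_fun = "real^'d \<Rightarrow> real"
type_synonym 'd face_fun = "'d \<Rightarrow> real^'d \<Rightarrow> real"

datatype phase = Wetting | Nonwetting

definition uniform_grid :: "real^'d \<Rightarrow> real^'d \<Rightarrow> real \<Rightarrow> ('d \<Rightarrow> nat) \<Rightarrow> bool" where
  "uniform_grid a b h N \<longleftrightarrow> h > 0 \<and> (\<forall>l. N l > 0 \<and> real (N l) = (b $ l - a $ l) / h)"

definition cell_centers :: "real^'d \<Rightarrow> real \<Rightarrow> ('d \<Rightarrow> nat) \<Rightarrow> (real^'d) set" where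
  "cell_centers a h N =
     {x. \<exists>i :: 'd \<Rightarrow> nat. \<forall>l. i l < N l \<and> x $ l = a $ l + (real (i l) + 1 / 2) * h}"

definition half_step :: "real \<Rightarrow> 'd \<Rightarrow> real^'d" where
  "half_step h l = (h / 2) *\<^sub>R axis l 1"

definition interior_faces :: "real^'d \<Rightarrow> real \<Rightarrow> ('d \<Rightarrow> nat) \<Rightarrow> ('d \<times> (real^'d)) set" where
  "interior_faces a h N =
     {(l, y). y - half_step h l \<in> cell_centers a h N \<and> y + half_step h l \<in> cell_centers a h N}"

definition grad_h :: "real \<Rightarrow> ('d::finite) cell_fun \<Rightarrow> 'd face_fun" where
  "grad_h h c l y = (c (y + half_step h l) - c (y - half_step h l)) / h"

definition div_h :: "real \<Rightarrow> ('d::finite) face_fun \<Rightarrow> 'd cell_fun" where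
  "div_h h u x = (\<Sum>l\<in>UNIV. (u l (x + half_step h l) - u l (x - half_step h l)) / h)"

text \<open>The flux $M \nabla_h c$ with the no-flow condition: it vanishes on boundary faces.\<close>

definition no_flow_flux ::
    "real^'d \<Rightarrow> real \<Rightarrow> ('d \<Rightarrow> nat) \<Rightarrow> 'd face_fun \<Rightarrow> 'd cell_fun \<Rightarrow> 'd face_fun" where
  "no_flow_flux a h N M c l y =
     (if (l, y) \<in> interior_faces a h N then M l y * grad_h h c l y else 0)"

definition inner_h ::
    "real^'d \<Rightarrow> real \<Rightarrow> ('d \<Rightarrow> nat) \<Rightarrow> 'd cell_fun \<Rightarrow> 'd cell_fun \<Rightarrow> real" where
  "inner_h a h N c c' = h ^ CARD('d) * (\<Sum>x\<in>cell_centers a h N. c x * c' x)"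

definition face_norm_h :: "real^'d \<Rightarrow> real \<Rightarrow> ('d \<Rightarrow> nat) \<Rightarrow> 'd face_fun \<Rightarrow> real" where
  "face_norm_h a h N u = sqrt (h ^ CARD('d) * (\<Sum>(l, y)\<in>interior_faces a h N. (u l y)\<^sup>2))"

definition H_quot :: "real \<Rightarrow> real \<Rightarrow> real" where
  "H_quot x a = (if x = a then ln a + 1 else (x * ln x - a * ln a) / (x - a))"

text \<open>
  The real power $x^m$ for $m > 0$, used only where it exists: for every real $x$ if $m$ is
  an integer, and for $x \geq 0$ otherwise. The extrapolated saturation can be negative, and there
  \<open>powr\<close> does not agree with the integer power, hence the case distinction.
\<close>

definition real_pow :: "real \<Rightarrow> real \<Rightarrow> real" where
  "real_pow x m = (if m \<in> \<nat> then x ^ nat \<lfloor>m\<rfloor> else x powr m)"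

definition real_pow_defined :: "real \<Rightarrow> real \<Rightarrow> bool" where
  "real_pow_defined x m \<longleftrightarrow> m \<in> \<nat> \<or> x \<ge> 0"

definition extrapolated :: "(nat \<Rightarrow> ('d::finite) cell_fun) \<Rightarrow> nat \<Rightarrow> 'd cell_fun" where
  "extrapolated S k x = 3 / 2 * S k x - 1 / 2 * S (k - 1) x"

definition mobility_mean ::
    "real \<Rightarrow> real \<Rightarrow> real \<Rightarrow> real \<Rightarrow> ('d::finite) cell_fun \<Rightarrow> 'd face_fun" where
  "mobility_mean h K m \<eta> S l y =
     (K * real_pow (S (y - half_step h l)) m / \<eta> + K * real_pow (S (y + half_step h l)) m / \<eta>) / 2"

text \<open>The flag \<open>reg\<close> selects the regularized variant.\<close>

definition face_mobility ::
    "bool \<Rightarrow> real \<Rightarrow> real \<Rightarrow> real \<Rightarrow> real \<Rightarrow> real \<Rightarrow> ('d::finite) cell_fun \<Rightarrow> 'd face_fun" where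
  "face_mobility reg \<Delta>t h K m \<eta> S l y =
     (if reg then sqrt ((mobility_mean h K m \<eta> S l y)\<^sup>2 + \<Delta>t ^ 6) else mobility_mean h K m \<eta> S l y)"

definition face_mobility_defined ::
    "real^'d \<Rightarrow> real \<Rightarrow> ('d \<Rightarrow> nat) \<Rightarrow> real \<Rightarrow> 'd cell_fun \<Rightarrow> bool" where
  "face_mobility_defined a h N m S \<longleftrightarrow>
     (\<forall>(l, y)\<in>interior_faces a h N.
        real_pow_defined (S (y - half_step h l)) m \<and> real_pow_defined (S (y + half_step h l)) m)"

definition free_energy :: "(phase \<Rightarrow> real) \<Rightarrow> real \<Rightarrow> real \<Rightarrow> real \<Rightarrow> real" where
  "free_energy \<sigma> \<sigma>wn Sw Sn =
     \<sigma> Wetting * Sw * (ln Sw - 1) + \<sigma> Nonwetting * Sn * (ln Sn - 1) + \<sigma>wn * Sw * Sn"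

definition total_energy ::
    "real^'d \<Rightarrow> real \<Rightarrow> ('d \<Rightarrow> nat) \<Rightarrow> (phase \<Rightarrow> real) \<Rightarrow> real \<Rightarrow> 'd cell_fun
      \<Rightarrow> (phase \<Rightarrow> nat \<Rightarrow> 'd cell_fun) \<Rightarrow> nat \<Rightarrow> real" where
  "total_energy a h N \<sigma> \<sigma>wn \<phi> S k =
     inner_h a h N \<phi> (\<lambda>x. free_energy \<sigma> \<sigma>wn (S Wetting k x) (S Nonwetting k x))"

end

theory Submission
  imports Defs
begin

text \<open>
  The secant quotient satisfies $(x - a)(\mathcal H(x,a) - 1) = x(\ln x - 1) - a(\ln a - 1)$ exactly,
  and averaging the other phase makes the interaction term telescope exactly as well. Hence the
  only discrepancy between the increment of $F$ and $\sum_\alpha \mu_\alpha \, \delta S_\alpha$ is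
  $\Delta t \sum_\alpha (\ln x_\alpha - \ln a_\alpha)(x_\alpha - a_\alpha) \ge 0$. The pressure drops
  out because the increments of the two saturations cancel, and testing the mass balance with
  $p + \mu_\alpha$ and summing by parts turns the right-hand side into the dissipation.
\<close>

text \<open>Each center comes from a multi-index in the finite box of all \<open>i\<close> with
  \<open>i l < N l\<close>.\<close>

lemma finite_cell_centers: "finite (cell_centers a h N)"
proof -
  have "x \<in> (\<lambda>i. \<chi> l. a $ l + (real (i l) + 1 / 2) * h) ` (\<Pi>\<^sub>E l\<in>UNIV. {..<N l})"
    if x: "x \<in> cell_centers a h N" for x
  proof -
    from x obtain i where "\<forall>l. i l < N l \<and> x $ l = a $ l + (real (i l) + 1 / 2) * h"
      by (auto simp: cell_centers_def)
    then show ?thesis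
      by (intro image_eqI[of _ _ i]) (auto simp: vec_eq_iff)
  qed
  then have "cell_centers a h N \<subseteq> (\<lambda>i. \<chi> l. a $ l + (real (i l) + 1 / 2) * h) ` (\<Pi>\<^sub>E l\<in>UNIV. {..<N l})"
    by blast
  then show ?thesis
    by (rule finite_subset) (simp add: finite_PiE)
qed

text \<open>Grouping the faces by direction lets a sum over faces become an iterated sum. The left
  side reappears on the right, so the equation is meant for a single \<open>subst\<close>.\<close>

lemma interior_faces_Sigma:
  "interior_faces a h N = (SIGMA l:UNIV. {y. (l, y) \<in> interior_faces a h N})"
  by auto

lemma finite_interior_faces_section: "finite {y. (l, y) \<in> interior_faces a h N}"
  by (rule finite_subset[OF _ finite_imageI[OF finite_cell_centers,
        where h = "\<lambda>x. x + half_step h l"]])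
    (auto simp: interior_faces_def intro: image_eqI[of _ _ "_ - half_step h l"])

lemma sum_interior_faces:
  "(\<Sum>(l, y)\<in>interior_faces a h N. f l y)
     = (\<Sum>l\<in>UNIV. \<Sum>y\<in>{y. (l, y) \<in> interior_faces a h N}. f l y)"
  by (subst interior_faces_Sigma, subst sum.Sigma)
    (simp_all add: finite_interior_faces_section)

text \<open>Substitute \<open>y = x + half_step h l\<close>, which sends a cell to its upper face in
  direction \<open>l\<close>. The cells whose upper face lies on the boundary drop out because
  \<open>u\<close> vanishes there.\<close>

lemma sum_upper_faces:
  fixes u :: "('d::finite) face_fun"
  assumes "\<And>l y. (l, y) \<notin> interior_faces a h N \<Longrightarrow> u l y = 0"
  shows "(\<Sum>x\<in>cell_centers a h N. c x * u l (x + half_step h l))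
           = (\<Sum>y\<in>{y. (l, y) \<in> interior_faces a h N}. c (y - half_step h l) * u l y)"
proof -
  have "(\<Sum>y\<in>{y. (l, y) \<in> interior_faces a h N}. c (y - half_step h l) * u l y)
      = (\<Sum>y\<in>(\<lambda>x. x + half_step h l) ` cell_centers a h N. c (y - half_step h l) * u l y)"
    \<comment> \<open>Every interior face is the upper face of a cell; the faces added by the larger
      index set are not interior and contribute 0.\<close>
    by (rule sum.mono_neutral_left)
      (use assms in \<open>auto simp: finite_cell_centers interior_faces_def
        intro: image_eqI[of _ _ "_ - half_step h l"]\<close>)
  then show ?thesis
    by (simp add: sum.reindex)
qed

text \<open>Mirror image of \<open>sum_upper_faces\<close>: a cell is sent to its lower face, so it
  lies on the upper side of that face.\<close>

lemma sum_lower_faces: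
  fixes u :: "('d::finite) face_fun"
  assumes "\<And>l y. (l, y) \<notin> interior_faces a h N \<Longrightarrow> u l y = 0"
  shows "(\<Sum>x\<in>cell_centers a h N. c x * u l (x - half_step h l))
           = (\<Sum>y\<in>{y. (l, y) \<in> interior_faces a h N}. c (y + half_step h l) * u l y)"
proof -
  have "(\<Sum>y\<in>{y. (l, y) \<in> interior_faces a h N}. c (y + half_step h l) * u l y)
      = (\<Sum>y\<in>(\<lambda>x. x - half_step h l) ` cell_centers a h N. c (y + half_step h l) * u l y)"
    by (rule sum.mono_neutral_left)
      (use assms in \<open>auto simp: finite_cell_centers interior_faces_def
        intro: image_eqI[of _ _ "_ + half_step h l"]\<close>)
  then show ?thesis
    by (simp add: sum.reindex inj_on_def)
qed

text \<open>Each interior face is met twice, with a plus sign from the cell below it and a minus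
  sign from the cell above it. No boundary terms arise, since \<open>u\<close> is 0 off the interior
  faces.\<close>

lemma summation_by_parts:
  fixes a :: "real^'d"
  assumes "\<And>l y. (l, y) \<notin> interior_faces a h N \<Longrightarrow> u l y = 0"
  shows "inner_h a h N c (div_h h u)
           = - (h ^ CARD('d) * (\<Sum>(l, y)\<in>interior_faces a h N. u l y * grad_h h c l y))"
proof -
  have "(\<Sum>x\<in>cell_centers a h N. c x * div_h h u x)
      = (\<Sum>l\<in>UNIV. ((\<Sum>x\<in>cell_centers a h N. c x * u l (x + half_step h l))
           - (\<Sum>x\<in>cell_centers a h N. c x * u l (x - half_step h l))) / h)"
    unfolding div_h_def sum_distrib_left
    by (subst sum.swap)
      (simp add: sum_subtractf[symmetric] sum_divide_distrib right_diff_distrib)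
  \<comment> \<open>Both cell sums now run over the same faces, so the values of \<open>c\<close> on
    the two sides combine into minus the difference quotient.\<close>
  also have "\<dots> = (\<Sum>l\<in>UNIV. \<Sum>y\<in>{y. (l, y) \<in> interior_faces a h N}. - (u l y * grad_h h c l y))"
    by (simp add: sum_upper_faces[where u = u, OF assms] sum_lower_faces[where u = u, OF assms]
        sum_subtractf[symmetric] sum_divide_distrib grad_h_def)
      (auto intro!: sum.cong simp: diff_divide_distrib algebra_simps simp flip: sum_negf)
  also have "\<dots> = - (\<Sum>(l, y)\<in>interior_faces a h N. u l y * grad_h h c l y)"
    by (simp add: sum_interior_faces sum_negf)
  finally show ?thesis
    by (simp add: inner_h_def)
qed

text \<open>The test function \<open>c\<close> also generates the flux, so summation by parts yields
  \<open>M\<close> times the squared gradient, a perfect square as \<open>M\<close> is nonnegative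
  on interior faces.\<close>

lemma inner_div_no_flow_flux:
  fixes a :: "real^'d"
  assumes "\<And>l y. (l, y) \<in> interior_faces a h N \<Longrightarrow> M l y \<ge> 0" and "h \<ge> 0"
  shows "inner_h a h N c (div_h h (no_flow_flux a h N M c))
           = - (face_norm_h a h N (\<lambda>l y. sqrt (M l y) * grad_h h c l y))\<^sup>2"
proof -
  have "(\<Sum>(l, y)\<in>interior_faces a h N. no_flow_flux a h N M c l y * grad_h h c l y)
      = (\<Sum>(l, y)\<in>interior_faces a h N. (sqrt (M l y) * grad_h h c l y)\<^sup>2)"
    using assms(1)
    by (intro sum.cong) (auto simp: no_flow_flux_def power_mult_distrib power2_eq_square)
  \<comment> \<open>This sign lets the square cancel the root in \<open>face_norm_h\<close>.\<close>
  moreover have "(\<Sum>(l, y)\<in>interior_faces a h N. (sqrt (M l y) * grad_h h c l y)\<^sup>2) \<ge> 0"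
    by (intro sum_nonneg) auto
  ultimately show ?thesis
    using assms(2)
    by (subst summation_by_parts) (auto simp: no_flow_flux_def face_norm_h_def)
qed

text \<open>A discrete chain rule for the entropy \<open>s * (ln s - 1)\<close>: multiplying by
  \<open>x - a\<close> clears the denominator, and for \<open>x = a\<close> both sides are
  0.\<close>

lemma H_quot_increment: "(x - a) * (H_quot x a - 1) = x * (ln x - 1) - a * (ln a - 1)"
proof -
  have "(x - a) * H_quot x a = x * ln x - a * ln a"
    by (cases "x = a") (simp_all add: H_quot_def)
  then show ?thesis
    by (simp add: algebra_simps)
qed

text \<open>By monotonicity of \<open>ln\<close> the two factors never have opposite signs.\<close>

lemma ln_increment_nonneg: "0 < x \<Longrightarrow> 0 < a \<Longrightarrow> 0 \<le> (x - a) * (ln x - ln a)" for x a :: real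
  by (cases "a \<le> x") (auto intro: mult_nonneg_nonneg mult_nonpos_nonpos)

lemma free_energy_increment_le:
  fixes dt :: real
  assumes "0 < x" "0 < a" "0 < y" "0 < b" "dt \<ge> 0"
  shows "free_energy \<sigma> \<sigma>wn x y - free_energy \<sigma> \<sigma>wn a b
    \<le> (x - a) * (\<sigma> Wetting * (H_quot x a - 1) + \<sigma>wn * ((y + b) / 2) + dt * (ln x - ln a))
     + (y - b) * (\<sigma> Nonwetting * (H_quot y b - 1) + \<sigma>wn * ((x + a) / 2) + dt * (ln y - ln b))"
proof -
  \<comment> \<open>The interaction terms combine by \<open>(x - a) * (y + b) / 2 + (y - b) * (x +
    a) / 2 = x * y - a * b\<close>, the cross terms cancelling.\<close>
  have "(x - a) * (\<sigma> Wetting * (H_quot x a - 1) + \<sigma>wn * ((y + b) / 2) + dt * (ln x - ln a))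
     + (y - b) * (\<sigma> Nonwetting * (H_quot y b - 1) + \<sigma>wn * ((x + a) / 2) + dt * (ln y - ln b))
    = \<sigma> Wetting * ((x - a) * (H_quot x a - 1)) + \<sigma> Nonwetting * ((y - b) * (H_quot y b - 1))
      + \<sigma>wn * (x * y - a * b)
      + dt * ((x - a) * (ln x - ln a)) + dt * ((y - b) * (ln y - ln b))"
    by (simp add: field_simps)
  also have "\<dots> = free_energy \<sigma> \<sigma>wn x y - free_energy \<sigma> \<sigma>wn a b
      + dt * ((x - a) * (ln x - ln a)) + dt * ((y - b) * (ln y - ln b))"
    unfolding H_quot_increment free_energy_def by (simp add: algebra_simps)
  finally show ?thesis
    using assms by (simp add: ln_increment_nonneg)
qed

theorem theorem4p3:
  fixes a b :: "real^'d" and h :: real and N :: "'d \<Rightarrow> nat"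
    and \<Delta>t m K \<sigma>wn :: real and \<eta> \<sigma> :: "phase \<Rightarrow> real"
    and \<phi> p :: "'d cell_fun" and \<mu> :: "phase \<Rightarrow> 'd cell_fun"
    and S :: "phase \<Rightarrow> nat \<Rightarrow> 'd cell_fun" and k :: nat
    and reg :: bool and M :: "phase \<Rightarrow> 'd face_fun"
  assumes dim: "CARD('d) \<in> {2, 3}"
    and grid: "uniform_grid a b h N"
    and params: "\<Delta>t > 0" "m > 0" "K > 0" "\<And>\<alpha>. \<eta> \<alpha> > 0" "\<And>\<alpha>. \<sigma> \<alpha> > 0" "\<sigma>wn > 0"
    and porosity: "\<And>x. x \<in> cell_centers a h N \<Longrightarrow> 0 < \<phi> x \<and> \<phi> x < 1"
    and k: "k \<ge> 1"
    and range: "\<And>\<alpha> j x. j \<in> {k - 1, k, k + 1} \<Longrightarrow> x \<in> cell_centers a h N \<Longrightarrow>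
                  0 < S \<alpha> j x \<and> S \<alpha> j x < 1"
    and saturation: "\<And>j x. j \<in> {k - 1, k, k + 1} \<Longrightarrow> x \<in> cell_centers a h N \<Longrightarrow>
                  S Wetting j x + S Nonwetting j x = 1"
    and mobility: "\<And>\<alpha>. M \<alpha> = face_mobility reg \<Delta>t h K m (\<eta> \<alpha>) (extrapolated (S \<alpha>) k)"
    and mobility_defined: "\<And>\<alpha>. face_mobility_defined a h N m (extrapolated (S \<alpha>) k)"
    and mobility_pos: "\<And>\<alpha> l y. (l, y) \<in> interior_faces a h N \<Longrightarrow> M \<alpha> l y > 0"
    and mass_balance: "\<And>\<alpha> x. x \<in> cell_centers a h N \<Longrightarrow>
          \<phi> x * ((S \<alpha> (k + 1) x - S \<alpha> k x) / \<Delta>t)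
            - div_h h (no_flow_flux a h N (M \<alpha>) (\<lambda>z. p z + \<mu> \<alpha> z)) x = 0"
    and potential_w: "\<And>x. x \<in> cell_centers a h N \<Longrightarrow>
          \<mu> Wetting x = \<sigma> Wetting * (H_quot (S Wetting (k + 1) x) (S Wetting k x) - 1)
            + \<sigma>wn * ((S Nonwetting (k + 1) x + S Nonwetting k x) / 2)
            + \<Delta>t * (ln (S Wetting (k + 1) x) - ln (S Wetting k x))"
    and potential_n: "\<And>x. x \<in> cell_centers a h N \<Longrightarrow>
          \<mu> Nonwetting x = \<sigma> Nonwetting * (H_quot (S Nonwetting (k + 1) x) (S Nonwetting k x) - 1)
            + \<sigma>wn * ((S Wetting (k + 1) x + S Wetting k x) / 2)
            + \<Delta>t * (ln (S Nonwetting (k + 1) x) - ln (S Nonwetting k x))"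
  shows "(total_energy a h N \<sigma> \<sigma>wn \<phi> S (k + 1) - total_energy a h N \<sigma> \<sigma>wn \<phi> S k) / \<Delta>t
           \<le> - (\<Sum>\<alpha>\<in>{Wetting, Nonwetting}.
                  (face_norm_h a h N
                     (\<lambda>l y. sqrt (M \<alpha> l y) * grad_h h (\<lambda>z. p z + \<mu> \<alpha> z) l y))\<^sup>2)
         \<and> - (\<Sum>\<alpha>\<in>{Wetting, Nonwetting}.
                  (face_norm_h a h N
                     (\<lambda>l y. sqrt (M \<alpha> l y) * grad_h h (\<lambda>z. p z + \<mu> \<alpha> z) l y))\<^sup>2) \<le> 0"
proof -
  let ?C = "cell_centers a h N"
  let ?c = "\<lambda>\<alpha> z. p z + \<mu> \<alpha> z"
  let ?D = "\<lambda>\<alpha>. div_h h (no_flow_flux a h N (M \<alpha>) (?c \<alpha>))"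
  let ?nrm = "\<lambda>\<alpha>. face_norm_h a h N (\<lambda>l y. sqrt (M \<alpha> l y) * grad_h h (?c \<alpha>) l y)"
  let ?F = "\<lambda>j x. free_energy \<sigma> \<sigma>wn (S Wetting j x) (S Nonwetting j x)"
  have h: "h \<ge> 0"
    using grid by (simp add: uniform_grid_def)
  have "\<phi> x * (?F (k + 1) x - ?F k x)
      \<le> \<Delta>t * (?c Wetting x * ?D Wetting x + ?c Nonwetting x * ?D Nonwetting x)"
    if x: "x \<in> ?C" for x
  proof -
    have D: "\<phi> x * (S \<alpha> (k + 1) x - S \<alpha> k x) = \<Delta>t * ?D \<alpha> x" for \<alpha>
      using mass_balance[OF x, of \<alpha>] params(1) by (simp add: field_simps)
    have "?F (k + 1) x - ?F k x
        \<le> (S Wetting (k + 1) x - S Wetting k x) * \<mu> Wetting x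
         + (S Nonwetting (k + 1) x - S Nonwetting k x) * \<mu> Nonwetting x"
      unfolding potential_w[OF x] potential_n[OF x]
      using range[OF _ x] params(1) by (intro free_energy_increment_le) auto
    \<comment> \<open>Adding this zero replaces each \<open>\<mu> \<alpha>\<close> by
      \<open>p + \<mu> \<alpha>\<close>, the function whose gradient drives the flux.\<close>
    moreover have "(S Wetting (k + 1) x - S Wetting k x) * p x
        + (S Nonwetting (k + 1) x - S Nonwetting k x) * p x = 0"
    proof -
      have "(S Wetting (k + 1) x - S Wetting k x) + (S Nonwetting (k + 1) x - S Nonwetting k x) = 0"
        using saturation[OF _ x, of k] saturation[OF _ x, of "k + 1"] by simp
      then show ?thesis
        unfolding distrib_right[symmetric] by simp
    qed
    ultimately have "?F (k + 1) x - ?F k x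
        \<le> (S Wetting (k + 1) x - S Wetting k x) * ?c Wetting x
         + (S Nonwetting (k + 1) x - S Nonwetting k x) * ?c Nonwetting x"
      unfolding distrib_left by linarith
    \<comment> \<open>Weighting by the positive porosity keeps the inequality and produces the
      products that \<open>D\<close> rewrites as divergences.\<close>
    then have "\<phi> x * (?F (k + 1) x - ?F k x)
        \<le> \<phi> x * ((S Wetting (k + 1) x - S Wetting k x) * ?c Wetting x
         + (S Nonwetting (k + 1) x - S Nonwetting k x) * ?c Nonwetting x)"
      using porosity[OF x] by (intro mult_left_mono) auto
    also have "\<dots> = (\<phi> x * (S Wetting (k + 1) x - S Wetting k x)) * ?c Wetting x
        + (\<phi> x * (S Nonwetting (k + 1) x - S Nonwetting k x)) * ?c Nonwetting x"
      by (simp add: distrib_left mult.assoc)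
    finally show ?thesis
      unfolding D by (simp add: distrib_left mult_ac)
  qed
  then have "(\<Sum>x\<in>?C. \<phi> x * (?F (k + 1) x - ?F k x))
      \<le> (\<Sum>x\<in>?C. \<Delta>t * (?c Wetting x * ?D Wetting x + ?c Nonwetting x * ?D Nonwetting x))"
    by (rule sum_mono)
  then have "h ^ CARD('d) * (\<Sum>x\<in>?C. \<phi> x * (?F (k + 1) x - ?F k x))
      \<le> h ^ CARD('d) * (\<Sum>x\<in>?C. \<Delta>t * (?c Wetting x * ?D Wetting x + ?c Nonwetting x * ?D Nonwetting x))"
    using h by (intro mult_left_mono) auto
  also have "\<dots> = \<Delta>t * (inner_h a h N (?c Wetting) (?D Wetting)
      + inner_h a h N (?c Nonwetting) (?D Nonwetting))"
    unfolding inner_h_def sum_distrib_left[symmetric] sum.distrib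
    by (simp only: distrib_left mult_ac)
  \<comment> \<open>In each phase the divergence is tested with the very potential that defines its
    flux, so \<open>inner_div_no_flow_flux\<close> applies.\<close>
  also have "\<dots> = \<Delta>t * - (\<Sum>\<alpha>\<in>{Wetting, Nonwetting}. (?nrm \<alpha>)\<^sup>2)"
    using mobility_pos h by (simp add: inner_div_no_flow_flux less_imp_le)
  finally have "total_energy a h N \<sigma> \<sigma>wn \<phi> S (k + 1) - total_energy a h N \<sigma> \<sigma>wn \<phi> S k
      \<le> \<Delta>t * - (\<Sum>\<alpha>\<in>{Wetting, Nonwetting}. (?nrm \<alpha>)\<^sup>2)"
    unfolding total_energy_def inner_h_def
    by (simp only: right_diff_distrib sum_subtractf)
  then show ?thesis
    using params(1) by (auto simp: pos_divide_le_eq mult.commute)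
qed

end
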